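(* Let $G$ be a finite median graph and let $m$ be the maximum dimension of a hypercube contained in $G$. Then $C(G,x)=\sum_{i=0}^m b_i(G)(x+1)^i$, where $b_0(G)=1$ and $b_i(G)$ is a positive integer for each $0\le i\le m$.
   Context: A median of vertices $u,v,w$ of a graph is a vertex lying simultaneously on a shortest $u,v$-path, a shortest $u,w$-path and a shortest $v,w$-path; a (connected) graph is a median graph if every triple of vertices has a unique median. The cube polynomial of $G$ is $C(G,x)=\sum_{i\ge0}\alpha_i(G)x^i$, where $\alpha_i(G)$ is the number of induced subgraphs of $G$ isomorphic to the $i$-dimensional hypercube $Q_i$. *)

theory Defs
  imports "HOL-Computational_Algebra.Polynomial"
begin

definition simple_graph :: "'a set \<Rightarrow> ('a \<Rightarrow> 'a \<Rightarrow> bool) \<Rightarrow> bool" where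
  "simple_graph V E \<longleftrightarrow> (\<forall>u v. E u v \<longrightarrow> u \<in> V \<and> v \<in> V \<and> u \<noteq> v \<and> E v u)"

definition walk :: "'a set \<Rightarrow> ('a \<Rightarrow> 'a \<Rightarrow> bool) \<Rightarrow> 'a list \<Rightarrow> bool" where
  "walk V E p \<longleftrightarrow> p \<noteq> [] \<and> set p \<subseteq> V \<and> (\<forall>i. Suc i < length p \<longrightarrow> E (p ! i) (p ! Suc i))"

definition walk_betw :: "'a set \<Rightarrow> ('a \<Rightarrow> 'a \<Rightarrow> bool) \<Rightarrow> 'a \<Rightarrow> 'a list \<Rightarrow> 'a \<Rightarrow> bool" where
  "walk_betw V E u p v \<longleftrightarrow> walk V E p \<and> hd p = u \<and> last p = v"

definition connected_graph :: "'a set \<Rightarrow> ('a \<Rightarrow> 'a \<Rightarrow> bool) \<Rightarrow> bool" where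
  "connected_graph V E \<longleftrightarrow> V \<noteq> {} \<and> (\<forall>u\<in>V. \<forall>v\<in>V. \<exists>p. walk_betw V E u p v)"

definition gdist :: "'a set \<Rightarrow> ('a \<Rightarrow> 'a \<Rightarrow> bool) \<Rightarrow> 'a \<Rightarrow> 'a \<Rightarrow> nat" where
  "gdist V E u v = (LEAST n. \<exists>p. walk_betw V E u p v \<and> length p = Suc n)"

definition on_geodesic :: "'a set \<Rightarrow> ('a \<Rightarrow> 'a \<Rightarrow> bool) \<Rightarrow> 'a \<Rightarrow> 'a \<Rightarrow> 'a \<Rightarrow> bool" where
  "on_geodesic V E u v x \<longleftrightarrow>
     (\<exists>p. walk_betw V E u p v \<and> length p = Suc (gdist V E u v) \<and> x \<in> set p)"

definition is_median :: "'a set \<Rightarrow> ('a \<Rightarrow> 'a \<Rightarrow> bool) \<Rightarrow> 'a \<Rightarrow> 'a \<Rightarrow> 'a \<Rightarrow> 'a \<Rightarrow> bool" where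
  "is_median V E u v w x \<longleftrightarrow> x \<in> V \<and>
     on_geodesic V E u v x \<and> on_geodesic V E u w x \<and> on_geodesic V E v w x"

definition median_graph :: "'a set \<Rightarrow> ('a \<Rightarrow> 'a \<Rightarrow> bool) \<Rightarrow> bool" where
  "median_graph V E \<longleftrightarrow> simple_graph V E \<and> connected_graph V E \<and>
     (\<forall>u\<in>V. \<forall>v\<in>V. \<forall>w\<in>V. \<exists>!x. is_median V E u v w x)"

text \<open>The hypercube Q_i: vertices are subsets of {0..<i}, adjacent iff they differ in one element.\<close>

definition hypercube_adj :: "nat set \<Rightarrow> nat set \<Rightarrow> bool" where
  "hypercube_adj A B \<longleftrightarrow> card ((A - B) \<union> (B - A)) = 1"

definition induces_cube :: "'a set \<Rightarrow> ('a \<Rightarrow> 'a \<Rightarrow> bool) \<Rightarrow> nat \<Rightarrow> 'a set \<Rightarrow> bool" where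
  "induces_cube V E i S \<longleftrightarrow> S \<subseteq> V \<and>
     (\<exists>f. bij_betw f (Pow {..<i}) S \<and>
          (\<forall>A\<in>Pow {..<i}. \<forall>B\<in>Pow {..<i}. E (f A) (f B) \<longleftrightarrow> hypercube_adj A B))"

definition cube_count :: "'a set \<Rightarrow> ('a \<Rightarrow> 'a \<Rightarrow> bool) \<Rightarrow> nat \<Rightarrow> nat" where
  "cube_count V E i = card {S. induces_cube V E i S}"

text \<open>Cube polynomial (for finite V; alpha_i = 0 for i > |V|).\<close>

definition cube_poly :: "'a set \<Rightarrow> ('a \<Rightarrow> 'a \<Rightarrow> bool) \<Rightarrow> int poly" where
  "cube_poly V E = (\<Sum>i\<le>card V. monom (int (cube_count V E i)) i)"

definition max_cube_dim :: "'a set \<Rightarrow> ('a \<Rightarrow> 'a \<Rightarrow> bool) \<Rightarrow> nat" where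
  "max_cube_dim V E = Max {i. cube_count V E i > 0}"

end

theory Submission
  imports Defs
begin

text \<open>Fix a root \<open>r\<close> and call a neighbour of \<open>v\<close> a down-neighbour if it is closer to \<open>r\<close>. Every set
  \<open>A\<close> of down-neighbours of \<open>v\<close> spans a unique cube of dimension \<open>|A|\<close> with \<open>v\<close> as its vertex
  farthest from \<open>r\<close>, and every cube arises in this way from exactly one pair \<open>(v, A)\<close>. If \<open>v\<close> has
  \<open>k(v)\<close> down-neighbours, the cube polynomial is therefore the sum of \<open>(1 + x)^k(v)\<close> over all
  vertices \<open>v\<close>, so that \<open>b i\<close> counts the vertices with \<open>k(v) = i\<close>. Only \<open>r\<close> has \<open>k(r) = 0\<close>, and as
  \<open>k\<close> drops by at most one along a descending edge, it attains all values up to its maximum,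
  which is the maximum dimension of a cube.\<close>

section \<open>Intervals in median metrics\<close>

text \<open>The cube arguments use distances only. \<open>step\<close> makes \<open>d\<close> the
  path metric of the graph of pairs at distance 1, and \<open>median\<close> replaces shortest paths
  by equality in the triangle inequality.\<close>

locale finite_median_metric =
  fixes V :: "'a set" and d :: "'a \<Rightarrow> 'a \<Rightarrow> nat"
  assumes finite_V: "finite V"
    and sym: "u \<in> V \<Longrightarrow> v \<in> V \<Longrightarrow> d u v = d v u"
    and zero_iff: "u \<in> V \<Longrightarrow> v \<in> V \<Longrightarrow> d u v = 0 \<longleftrightarrow> u = v"
    and triangle: "u \<in> V \<Longrightarrow> v \<in> V \<Longrightarrow> w \<in> V \<Longrightarrow> d u w \<le> d u v + d v w"
    and step: "u \<in> V \<Longrightarrow> v \<in> V \<Longrightarrow> u \<noteq> v \<Longrightarrow> \<exists>x\<in>V. d u x = 1 \<and> d x v + 1 = d u v"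
    and median: "u \<in> V \<Longrightarrow> v \<in> V \<Longrightarrow> w \<in> V \<Longrightarrow>
      \<exists>!x. x \<in> V \<and> d u x + d x v = d u v \<and> d u x + d x w = d u w \<and> d v x + d x w = d v w"
begin

lemma self_zero [simp]: "u \<in> V \<Longrightarrow> d u u = 0"
  using zero_iff by blast

lemma obtain_median:
  assumes "u \<in> V" "v \<in> V" "w \<in> V"
  obtains x where "x \<in> V" "d u x + d x v = d u v" "d u x + d x w = d u w" "d v x + d x w = d v w"
  using median[OF assms] by blast

lemma median_unique:
  assumes "u \<in> V" "v \<in> V" "w \<in> V"
    and "x \<in> V" "d u x + d x v = d u v" "d u x + d x w = d u w" "d v x + d x w = d v w"
    and "y \<in> V" "d u y + d y v = d u v" "d u y + d y w = d u w" "d v y + d y w = d v w"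
  shows "x = y"
  using median[OF assms(1-3)] assms(4-) by blast

section \<open>Levels, squares and the exclusion of K_{2,3}\<close>

text \<open>The median of \<open>u\<close>, \<open>v\<close>, \<open>r\<close> lies between two
  adjacent vertices, so it is one of them. This is bipartiteness: no edge joins two vertices of the
  same level.\<close>

lemma adjacent_levels:
  assumes "u \<in> V" "v \<in> V" "r \<in> V" "d u v = 1"
  shows "d u r = d v r + 1 \<or> d v r = d u r + 1"
proof -
  obtain m where m: "m \<in> V" "d u m + d m v = d u v" "d u m + d m r = d u r" "d v m + d m r = d v r"
    using obtain_median assms(1-3) by blast
  have "d u m = 0 \<or> d m v = 0" using m assms by linarith
  then have "m = u \<or> m = v" using zero_iff assms m by blast
  then show ?thesis using m assms sym by auto
qed

text \<open>Distance 1 would put the adjacent vertices \<open>u\<close> and \<open>w\<close> on the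
  same level around \<open>v\<close>.\<close>

lemma common_neighbour_dist:
  assumes "u \<in> V" "v \<in> V" "w \<in> V" "d v u = 1" "d v w = 1" "u \<noteq> w"
  shows "d u w = 2"
proof -
  have "d u w \<le> 2" using triangle[of u v w] sym[of u v] assms by simp
  moreover have "d u w \<noteq> 0" using zero_iff assms by blast
  moreover have "d u w \<noteq> 1"
    using adjacent_levels[of u w v] sym[of u v] sym[of w v] assms by auto
  ultimately show ?thesis by linarith
qed

text \<open>Three common neighbours are pairwise at distance 2, so \<open>a\<close> and
  \<open>b\<close> are both medians of them.\<close>

lemma no_K23:
  assumes "a \<in> V" "b \<in> V" "x \<in> V" "y \<in> V" "z \<in> V"
    and "x \<noteq> y" "x \<noteq> z" "y \<noteq> z"
    and "d a x = 1" "d a y = 1" "d a z = 1" "d b x = 1" "d b y = 1" "d b z = 1"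
  shows "a = b"
proof -
  have "d x y = 2" "d x z = 2" "d y z = 2"
    using assms common_neighbour_dist[of _ a] by auto
  moreover have "d x a = 1" "d y a = 1" "d z a = 1" "d x b = 1" "d y b = 1" "d z b = 1"
    using assms sym by auto
  ultimately show ?thesis using assms by (intro median_unique[of x y z]) auto
qed

text \<open>The vertex \<open>c\<close> is the median of \<open>u\<close>, \<open>w\<close> and
  \<open>y\<close>; as \<open>u\<close> and \<open>w\<close> are equally far from \<open>y\<close>,
  it lies midway between them.\<close>

lemma quadrangle:
  assumes "u \<in> V" "v \<in> V" "w \<in> V" "y \<in> V" "d v u = 1" "d v w = 1" "u \<noteq> w" "d u y = d w y"
  obtains c where "c \<in> V" "d u c = 1" "d w c = 1" "d c y + 1 = d u y"
proof -
  have "d u w = 2" using common_neighbour_dist assms by blast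
  moreover obtain c where "c \<in> V" "d u c + d c w = d u w" "d u c + d c y = d u y" "d w c + d c y = d w y"
    using obtain_median assms by blast
  moreover have "d c w = d w c" using sym assms calculation by blast
  ultimately have "d u c = 1" "d w c = 1" "d c y + 1 = d u y" using assms by linarith+
  then show ?thesis using that \<open>c \<in> V\<close> by blast
qed

section \<open>Neighbours inside an interval and downward cubes\<close>

text \<open>For \<open>y = r\<close> these are the down-neighbours of \<open>v\<close>. Other
  \<open>y\<close> occur as well: the bottom vertex of a cube determines its edges at
  \<open>v\<close> in this way.\<close>

definition interval_nbrs :: "'a \<Rightarrow> 'a \<Rightarrow> 'a set" where
  "interval_nbrs v y = {a \<in> V. d v a = 1 \<and> d a y + 1 = d v y}"

lemma finite_interval_nbrs [simp]: "finite (interval_nbrs v y)"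
  unfolding interval_nbrs_def using finite_V by simp

text \<open>Fix one neighbour \<open>a\<close> of \<open>v\<close>. Completing each square \<open>a, v, b\<close> towards \<open>y\<close> maps the other
  neighbours \<open>b\<close> to neighbours of \<open>a\<close>, injectively because there is no \<open>K\<^sub>2\<^sub>,\<^sub>3\<close>.\<close>

lemma card_interval_nbrs_le:
  assumes "v \<in> V" "y \<in> V"
  shows "card (interval_nbrs v y) \<le> d v y"
  using assms(1)
proof (induction "d v y" arbitrary: v)
  case 0
  then have "interval_nbrs v y = {}" unfolding interval_nbrs_def by auto
  then show ?case by simp
next
  case (Suc k v)
  show ?case
  proof (cases "interval_nbrs v y = {}")
    case False
    then obtain a where a: "a \<in> interval_nbrs v y" by blast
    then have aV: "a \<in> V" "d v a = 1" "d a y = k" using Suc.hyps unfolding interval_nbrs_def by auto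
    define B where "B = interval_nbrs v y - {a}"
    have "\<exists>c\<in>V. d a c = 1 \<and> d b c = 1 \<and> d c y + 1 = d a y" if "b \<in> B" for b
    proof -
      have "b \<in> V" "d v b = 1" "d b y = k" "a \<noteq> b"
        using that Suc.hyps unfolding B_def interval_nbrs_def by auto
      then show ?thesis using quadrangle[of a v b y] aV Suc.prems assms(2) by metis
    qed
    then obtain c where c: "c b \<in> V" "d a (c b) = 1" "d b (c b) = 1" "d (c b) y + 1 = d a y"
      if "b \<in> B" for b by metis
    have "inj_on c B"
    proof (rule inj_onI, rule ccontr)
      fix b b' assume b: "b \<in> B" "b' \<in> B" "c b = c b'" "b \<noteq> b'"
      have "b \<in> V" "b' \<in> V" "a \<noteq> b" "a \<noteq> b'" "d v b = 1" "d v b' = 1"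
        using b unfolding B_def interval_nbrs_def by auto
      moreover have "d (c b) a = 1" "d (c b) b = 1" "d (c b) b' = 1"
        using b c[OF b(1)] c[OF b(2)] sym aV calculation by auto
      \<comment> \<open>\<open>v\<close> and \<open>c b\<close> share the neighbours
        \<open>a\<close>, \<open>b\<close>, \<open>b'\<close>; yet \<open>c b\<close> is two steps
        closer to \<open>y\<close>.\<close>
      ultimately have "v = c b"
        using no_K23[of v "c b" a b b'] Suc.prems aV c(1)[OF b(1)] b by blast
      then show False using c(4)[OF b(1)] Suc.hyps aV by simp
    qed
    moreover have "c ` B \<subseteq> interval_nbrs a y" using c unfolding interval_nbrs_def by auto
    ultimately have "card B \<le> card (interval_nbrs a y)" by (intro card_inj_on_le) auto
    also have "\<dots> \<le> k" using Suc.hyps(1)[of a] aV by simp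
    finally have "card B \<le> k" .
    then show ?thesis using Suc.hyps(2) a unfolding B_def by simp
  qed simp
qed

text \<open>\<open>corner r v A y\<close>: the cube spanned downwards by \<open>A\<close> from \<open>v\<close> has \<open>y\<close> as the vertex opposite \<open>v\<close>.\<close>

definition corner :: "'a \<Rightarrow> 'a \<Rightarrow> 'a set \<Rightarrow> 'a \<Rightarrow> bool" where
  "corner r v A y \<longleftrightarrow> y \<in> V \<and> d v y + d y r = d v r \<and> d v y = card A \<and> A \<subseteq> interval_nbrs v y"

text \<open>The equality case of the degree bound: \<open>A\<close> already has \<open>d v y\<close>
  elements.\<close>

lemma corner_interval_nbrs:
  assumes "v \<in> V" "corner r v A y"
  shows "interval_nbrs v y = A"
  using assms card_interval_nbrs_le[of v y] card_seteq[of "interval_nbrs v y" A]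
  unfolding corner_def by auto

text \<open>Induction on \<open>A\<close>: when \<open>a\<close> joins, the new opposite vertex is
  the median of \<open>a\<close>, the old opposite vertex \<open>z\<close> and
  \<open>r\<close>.\<close>

lemma corner_exists:
  assumes "r \<in> V" "v \<in> V" "A \<subseteq> interval_nbrs v r"
  shows "\<exists>y. corner r v A y"
proof -
  have "finite A" using assms finite_subset by fastforce
  then show ?thesis using assms(3)
  proof (induction A)
    case empty
    then show ?case using assms unfolding corner_def by auto
  next
    case (insert a A)
    then obtain z where z: "corner r v A z" by auto
    then have zV: "z \<in> V" "d v z + d z r = d v r" "d v z = card A" unfolding corner_def by auto
    have a: "a \<in> V" "d v a = 1" "d a r + 1 = d v r"
      using insert.prems unfolding interval_nbrs_def by auto
    \<comment> \<open>No neighbour outside \<open>A\<close> leads towards \<open>z\<close>, so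
      \<open>a\<close> is farther from \<open>z\<close> than \<open>v\<close> is.\<close>
    have "a \<notin> interval_nbrs v z" using corner_interval_nbrs[OF assms(2) z] insert.hyps by simp
    then have az: "d a z = d v z + 1"
      using adjacent_levels[of v a z] assms a zV unfolding interval_nbrs_def by auto
    obtain m where m: "m \<in> V" "d a m + d m z = d a z" "d a m + d m r = d a r" "d z m + d m r = d z r"
      using obtain_median assms(1) a zV by blast
    \<comment> \<open>The three median equations now determine all distances: \<open>m\<close> is
      one step below \<open>z\<close>.\<close>
    have "d m z = d z m" using sym m zV by blast
    then have m1: "d z m = 1" "d a m = card A" "d m r + card A + 1 = d v r"
      using m a az zV by linarith+
    have "d v r \<le> d v m + d m r" "d v m \<le> d v a + d a m"
      using assms m a by (blast intro: triangle)+
    then have vm: "d v m = card A + 1" using m1 a by linarith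
    have "b \<in> interval_nbrs v m" if "b \<in> A" for b
    proof -
      have b: "b \<in> V" "d v b = 1" "d b z + 1 = d v z"
        using z that unfolding corner_def interval_nbrs_def by auto
      have "d b m \<le> d b z + d z m" "d v m \<le> d v b + d b m"
        using assms b m zV by (blast intro: triangle)+
      then show ?thesis using b m1 vm zV unfolding interval_nbrs_def by auto
    qed
    moreover have "a \<in> interval_nbrs v m" using a m1 vm unfolding interval_nbrs_def by auto
    ultimately have "corner r v (insert a A) m"
      unfolding corner_def using vm m1 m insert.hyps by auto
    then show ?case by blast
  qed
qed

text \<open>The median \<open>m\<close> of \<open>v, y, z\<close> has all of \<open>X\<close> in the interval from \<open>v\<close>, so the degree bound
  forces \<open>m = y\<close>.\<close>

lemma corner_mono:
  assumes "v \<in> V" "corner r v X y" "corner r v Y z" "X \<subseteq> Y"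
  shows "d v y + d y z = d v z"
proof -
  have V: "y \<in> V" "z \<in> V" using assms unfolding corner_def by auto
  obtain m where m: "m \<in> V" "d v m + d m y = d v y" "d v m + d m z = d v z" "d y m + d m z = d y z"
    using obtain_median assms(1) V by blast
  have "X \<subseteq> interval_nbrs v m"
  proof
    fix a assume "a \<in> X"
    then have a: "a \<in> V" "d v a = 1" "d a y + 1 = d v y" "d a z + 1 = d v z"
      using assms unfolding corner_def interval_nbrs_def by auto
    \<comment> \<open>The median of \<open>a\<close>, \<open>y\<close>, \<open>z\<close> turns out
      to be a median of \<open>v\<close>, \<open>y\<close>, \<open>z\<close> too, so it is
      \<open>m\<close>, and \<open>a\<close> lies between \<open>v\<close> and
      \<open>m\<close>.\<close>
    obtain n where n: "n \<in> V" "d a n + d n y = d a y" "d a n + d n z = d a z" "d y n + d n z = d y z"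
      using obtain_median a V by blast
    have "d v n \<le> d v a + d a n" "d v y \<le> d v n + d n y" "d v z \<le> d v n + d n z"
      using assms(1) a n V by (blast intro: triangle)+
    then have "d v n = d a n + 1" "d v n + d n y = d v y" "d v n + d n z = d v z"
      using n a by linarith+
    moreover from this have "n = m" using median_unique[of v y z n m] assms(1) V m n by blast
    ultimately show "a \<in> interval_nbrs v m" using a unfolding interval_nbrs_def by auto
  qed
  then have "card X \<le> d v m"
    using card_interval_nbrs_le[OF assms(1) m(1)] card_mono[of "interval_nbrs v m" X] by simp
  moreover have "d v y = card X" using assms unfolding corner_def by auto
  ultimately have "d m y = 0" using m by linarith
  then show ?thesis using m V zero_iff by auto
qed

text \<open>The case \<open>X = Y\<close> of monotonicity: both vertices are at distance
  \<open>card A\<close> from \<open>v\<close>, which leaves distance 0 between them.\<close>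

lemma corner_unique:
  assumes "v \<in> V" "corner r v A y" "corner r v A z"
  shows "y = z"
proof -
  have "d v y + d y z = d v z" "d v y = d v z"
    using corner_mono[OF assms] assms unfolding corner_def by auto
  then show ?thesis using assms zero_iff unfolding corner_def by auto
qed

section \<open>The cube as an image of a power set\<close>

text \<open>Well defined for sets of down-neighbours, by existence and uniqueness of corners. The
  images of the subsets of \<open>A\<close> will be the vertices of the cube spanned by
  \<open>A\<close>.\<close>

definition bottom :: "'a \<Rightarrow> 'a \<Rightarrow> 'a set \<Rightarrow> 'a" where
  "bottom r v A = (THE y. corner r v A y)"

lemma bottom_eq: "v \<in> V \<Longrightarrow> corner r v A y \<Longrightarrow> bottom r v A = y"
  unfolding bottom_def using corner_unique by blast

lemma corner_bottom:
  "r \<in> V \<Longrightarrow> v \<in> V \<Longrightarrow> A \<subseteq> interval_nbrs v r \<Longrightarrow> corner r v A (bottom r v A)"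
  using corner_exists bottom_eq by metis

lemma dist_bottom_mono:
  assumes "r \<in> V" "v \<in> V" "X \<subseteq> Y" "Y \<subseteq> interval_nbrs v r"
  shows "d (bottom r v X) (bottom r v Y) + card X = card Y"
proof -
  have c: "corner r v X (bottom r v X)" "corner r v Y (bottom r v Y)"
    using corner_bottom assms by auto
  show ?thesis
    using corner_mono[OF assms(2) c assms(3)] c unfolding corner_def by simp
qed

lemma bottom_level:
  assumes "r \<in> V" "v \<in> V" "X \<subseteq> interval_nbrs v r"
  shows "d (bottom r v X) r + card X = d v r"
  using corner_bottom[OF assms] unfolding corner_def by auto

lemma bottom_in_V:
  assumes "r \<in> V" "v \<in> V" "X \<subseteq> interval_nbrs v r"
  shows "bottom r v X \<in> V"
  using corner_bottom[OF assms] unfolding corner_def by auto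

text \<open>The set is recovered as the neighbours of \<open>v\<close> towards the bottom
  vertex.\<close>

lemma bottom_inj:
  assumes "r \<in> V" "v \<in> V" "X \<subseteq> interval_nbrs v r" "Y \<subseteq> interval_nbrs v r"
    and "bottom r v X = bottom r v Y"
  shows "X = Y"
  using assms corner_bottom corner_interval_nbrs by metis

lemma bottom_empty:
  assumes "v \<in> V"
  shows "bottom r v {} = v"
  using assms by (intro bottom_eq) (auto simp: corner_def)

lemma bottom_singleton:
  assumes "v \<in> V" "a \<in> interval_nbrs v r"
  shows "bottom r v {a} = a"
  using assms by (intro bottom_eq) (auto simp: corner_def interval_nbrs_def)

text \<open>The lower vertex is one step farther from \<open>v\<close>, so every neighbour of
  \<open>v\<close> towards the upper one also leads towards the lower one. Hence \<open>X\<close> is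
  contained in \<open>Y\<close>, with one element less.\<close>

lemma bottom_cover:
  assumes "r \<in> V" "v \<in> V" "X \<subseteq> interval_nbrs v r" "Y \<subseteq> interval_nbrs v r"
    and adj: "d (bottom r v X) (bottom r v Y) = 1"
    and lev: "d (bottom r v X) r = d (bottom r v Y) r + 1"
  shows "\<exists>a. a \<notin> X \<and> Y = insert a X"
proof -
  let ?x = "bottom r v X" and ?y = "bottom r v Y"
  have y_corner: "corner r v Y ?y" using corner_bottom assms by blast
  have x: "?x \<in> V" "d v ?x = card X" "X \<subseteq> interval_nbrs v ?x"
    and y: "?y \<in> V" "d v ?y = card Y"
    using y_corner corner_bottom[of r v X] assms unfolding corner_def by auto
  have card: "card Y = card X + 1"
    using bottom_level[OF assms(1-3)] bottom_level[OF assms(1,2,4)] lev by linarith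
  have "X \<subseteq> interval_nbrs v ?y"
  proof
    fix a assume "a \<in> X"
    then have a: "a \<in> V" "d v a = 1" "d a ?x + 1 = d v ?x"
      using x(3) unfolding interval_nbrs_def by auto
    have "d a ?y \<le> d a ?x + d ?x ?y" "d v ?y \<le> d v a + d a ?y"
      using assms(2) a x(1) y(1) by (blast intro: triangle)+
    then show "a \<in> interval_nbrs v ?y"
      unfolding interval_nbrs_def using a card x(2) y(2) adj by auto
  qed
  then have sub: "X \<subseteq> Y" using corner_interval_nbrs[OF assms(2) y_corner] by simp
  have "finite Y" using assms(4) finite_subset by fastforce
  then have "card (Y - X) = 1" using card sub finite_subset[OF sub] by (simp add: card_Diff_subset)
  then obtain a where "Y - X = {a}" by (auto simp: card_1_singleton_iff)
  then show ?thesis using sub by blast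
qed

text \<open>Adjacent vertices lie on consecutive levels, so one covers the other. This makes the
  spanned cube an induced one.\<close>

lemma bottom_adjacent_iff:
  assumes "r \<in> V" "v \<in> V" "X \<subseteq> interval_nbrs v r" "Y \<subseteq> interval_nbrs v r"
  shows "d (bottom r v X) (bottom r v Y) = 1 \<longleftrightarrow>
    (\<exists>a. a \<notin> X \<and> Y = insert a X) \<or> (\<exists>a. a \<notin> Y \<and> X = insert a Y)"
proof
  let ?x = "bottom r v X" and ?y = "bottom r v Y"
  have V: "?x \<in> V" "?y \<in> V" using bottom_in_V assms by auto
  have fin: "finite X" "finite Y" using assms finite_subset by fastforce+
  show "(\<exists>a. a \<notin> X \<and> Y = insert a X) \<or> (\<exists>a. a \<notin> Y \<and> X = insert a Y)" if "d ?x ?y = 1"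
    using that adjacent_levels[OF V assms(1) that] sym[OF V]
      bottom_cover[OF assms(1,2)] assms(3,4) by metis
  show "d ?x ?y = 1" if "(\<exists>a. a \<notin> X \<and> Y = insert a X) \<or> (\<exists>a. a \<notin> Y \<and> X = insert a Y)"
    using that
  proof
    assume "\<exists>a. a \<notin> X \<and> Y = insert a X"
    then show ?thesis using dist_bottom_mono[of r v X Y] assms fin by fastforce
  next
    assume "\<exists>a. a \<notin> Y \<and> X = insert a Y"
    then show ?thesis using dist_bottom_mono[of r v Y X] assms fin sym[OF V] by fastforce
  qed
qed

section \<open>Cubes and their vertices farthest from the root\<close>

text \<open>If \<open>g X\<close> were as far from \<open>r\<close> as \<open>g Z\<close>, where \<open>X = Z \<union> {j, l}\<close>, then \<open>g (Z \<union> {j})\<close> and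
  \<open>g (Z \<union> {l})\<close> would have three common neighbours: \<open>g Z\<close>, \<open>g X\<close> and one closer to \<open>r\<close>.\<close>

lemma cube_level:
  assumes "r \<in> V" "finite I" "inj_on g (Pow I)" "g ` Pow I \<subseteq> V"
    and adj: "\<And>X j. X \<subseteq> I \<Longrightarrow> j \<in> I \<Longrightarrow> j \<notin> X \<Longrightarrow> d (g X) (g (insert j X)) = 1"
    and top: "\<And>X. X \<subseteq> I \<Longrightarrow> d (g X) r \<le> d (g {}) r"
    and "X \<subseteq> I"
  shows "d (g X) r + card X = d (g {}) r"
  using assms(7)
proof (induction "card X" arbitrary: X rule: less_induct)
  case less
  have gV: "g Y \<in> V" if "Y \<subseteq> I" for Y using that assms(4) by auto
  have g_eq: "Y = Z" if "g Y = g Z" "Y \<subseteq> I" "Z \<subseteq> I" for Y Z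
    using that assms(3) unfolding inj_on_def by blast
  have finX: "finite X" using less.prems assms(2) finite_subset by blast
  show ?case
  proof (cases "X = {}")
    case False
    then obtain j Y where j: "X = insert j Y" "j \<notin> Y" by (meson Set.set_insert ex_in_conv)
    then have jY: "j \<in> I" "Y \<subseteq> I" using less.prems by auto
    show ?thesis
    proof (cases "Y = {}")
      case True
      \<comment> \<open>The edge from \<open>g {}\<close> to \<open>g {j}\<close> changes the level
        by one; \<open>top\<close> rules out going up.\<close>
      then show ?thesis
        using j adj[of "{}" j] jY adjacent_levels[of "g {}" "g {j}" r] gV assms(1) top[of X] less.prems
        by fastforce
    next
      case False
      then obtain l Z where l: "Y = insert l Z" "l \<notin> Z" by (meson Set.set_insert ex_in_conv)
      then have jl: "j \<noteq> l" "j \<notin> Z" "l \<in> I" "Z \<subseteq> I" "finite Z" using j jY finX by auto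
      define p q where "p = g (insert j Z)" and "q = g (insert l Z)"
      have X: "X = insert l (insert j Z)" "X = insert j (insert l Z)" using j l by auto
      have V: "p \<in> V" "q \<in> V" "g Z \<in> V" "g X \<in> V"
        unfolding p_def q_def using gV jY jl less.prems by auto
      have cards: "card X = card Z + 2" "card (insert j Z) = card Z + 1" "card (insert l Z) = card Z + 1"
        using X jl l by auto
      have lev: "d (g Z) r + card Z = d (g {}) r" "d p r + card Z + 1 = d (g {}) r"
          "d q r + card Z + 1 = d (g {}) r"
        unfolding p_def q_def
        using less.hyps[of Z] less.hyps[of "insert j Z"] less.hyps[of "insert l Z"] cards jY jl
        by auto
      have "p \<noteq> q" using g_eq[of "insert j Z" "insert l Z"] jl jY unfolding p_def q_def by blast
      have up: "d (g Z) p = 1" "d (g Z) q = 1"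
        unfolding p_def q_def using adj jl jY l by auto
      have down: "d p (g X) = 1" "d q (g X) = 1"
        unfolding p_def q_def using adj[of "insert j Z" l] adj[of "insert l Z" j] X jl jY l by auto
      \<comment> \<open>The square \<open>p\<close>, \<open>g Z\<close>, \<open>q\<close> is
        completed towards \<open>r\<close>, which gives the third common neighbour.\<close>
      obtain c where c: "c \<in> V" "d p c = 1" "d q c = 1" "d c r + 1 = d p r"
        using quadrangle[of p "g Z" q r] V assms(1) up \<open>p \<noteq> q\<close> lev by auto
      have "d (g X) r \<noteq> d p r + 1"
      proof
        assume eq: "d (g X) r = d p r + 1"
        have "g Z \<noteq> g X" using g_eq[of Z X] jl less.prems j by blast
        moreover have "g Z \<noteq> c" "g X \<noteq> c" using lev eq c by auto
        moreover have "d p (g Z) = 1" "d q (g Z) = 1" using up sym V by auto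
        ultimately show False
          using no_K23[of p q "g Z" "g X" c] V c down \<open>p \<noteq> q\<close> by blast
      qed
      then show ?thesis
        using adjacent_levels[of p "g X" r] V assms(1) down lev cards by auto
    qed
  qed simp
qed

text \<open>Elements of \<open>W\<close> are added one at a time, one edge each. The matching lower
  bound will come from levels.\<close>

lemma cube_dist_le:
  assumes "g ` Pow I \<subseteq> V"
    and adj: "\<And>X j. X \<subseteq> I \<Longrightarrow> j \<in> I \<Longrightarrow> j \<notin> X \<Longrightarrow> d (g X) (g (insert j X)) = 1"
    and "finite W" "W \<subseteq> I" "Z \<subseteq> I" "W \<inter> Z = {}"
  shows "d (g Z) (g (W \<union> Z)) \<le> card W"
  using assms(3-)
proof (induction W)
  case empty
  then have "g Z \<in> V" using assms(1) by blast
  then show ?case by simp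
next
  case (insert w W)
  have V: "g Z \<in> V" "g (W \<union> Z) \<in> V" "g (insert w (W \<union> Z)) \<in> V"
    using insert.prems assms(1) by auto
  have "d (g (W \<union> Z)) (g (insert w (W \<union> Z))) = 1"
    using insert by (intro adj) auto
  moreover have "d (g Z) (g (W \<union> Z)) \<le> card W" using insert by auto
  ultimately show ?case using triangle[OF V] insert.hyps by simp
qed

text \<open>Walking inside the cube bounds the distance from \<open>g {}\<close> to
  \<open>g X\<close> above by \<open>card X\<close>, and the drop in level bounds it below. The walk
  from \<open>g {j}\<close> saves one edge, so \<open>g {j}\<close> leads towards
  \<open>g X\<close>.\<close>

lemma cube_corner:
  assumes "r \<in> V" "finite I" "inj_on g (Pow I)" "g ` Pow I \<subseteq> V"
    and adj: "\<And>X j. X \<subseteq> I \<Longrightarrow> j \<in> I \<Longrightarrow> j \<notin> X \<Longrightarrow> d (g X) (g (insert j X)) = 1"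
    and top: "\<And>X. X \<subseteq> I \<Longrightarrow> d (g X) r \<le> d (g {}) r"
    and X: "X \<subseteq> I"
  shows "corner r (g {}) ((\<lambda>j. g {j}) ` X) (g X)"
proof -
  have gV: "g Y \<in> V" if "Y \<subseteq> I" for Y using that assms(4) by auto
  have finX: "finite X" using X assms(2) finite_subset by blast
  have "d (g {}) (g X) \<le> card X"
    using cube_dist_le[OF assms(4) adj, of X "{}"] X finX by auto
  moreover have "d (g {}) r \<le> d (g {}) (g X) + d (g X) r"
    using gV X assms(1) by (intro triangle) auto
  moreover have "d (g X) r + card X = d (g {}) r" by (rule cube_level) (use assms in auto)
  ultimately have dX: "d (g {}) (g X) = card X" "d (g {}) (g X) + d (g X) r = d (g {}) r"
    by linarith+
  have "inj_on (\<lambda>j. g {j}) X"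
    using assms(3) X unfolding inj_on_def by blast
  then have "card ((\<lambda>j. g {j}) ` X) = card X" by (rule card_image)
  moreover have "g {j} \<in> interval_nbrs (g {}) (g X)" if "j \<in> X" for j
  proof -
    have "d (g {j}) (g ((X - {j}) \<union> {j})) \<le> card (X - {j})"
      using X finX that by (intro cube_dist_le[OF assms(4) adj]) auto
    then have "d (g {j}) (g X) + 1 \<le> card X"
      using that finX card_Suc_Diff1[OF finX that] by (simp add: insert_absorb)
    moreover have "d (g {}) (g {j}) = 1" using adj[of "{}" j] that X by auto
    moreover have "d (g {}) (g X) \<le> d (g {}) (g {j}) + d (g {j}) (g X)"
      using gV X that by (intro triangle) auto
    ultimately show ?thesis unfolding interval_nbrs_def using gV X that dX by auto
  qed
  ultimately show ?thesis unfolding corner_def using dX gV X by auto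
qed

text \<open>The pair is \<open>v = g {}\<close> with \<open>A\<close> the set of all
  \<open>g {j}\<close>; uniqueness of corners identifies every other vertex of the cube.\<close>

lemma cube_eq_bottom_image:
  assumes "r \<in> V" "finite I" "inj_on g (Pow I)" "g ` Pow I \<subseteq> V"
    and adj: "\<And>X j. X \<subseteq> I \<Longrightarrow> j \<in> I \<Longrightarrow> j \<notin> X \<Longrightarrow> d (g X) (g (insert j X)) = 1"
    and top: "\<And>X. X \<subseteq> I \<Longrightarrow> d (g X) r \<le> d (g {}) r"
  shows "\<exists>v\<in>V. \<exists>A. A \<subseteq> interval_nbrs v r \<and> card A = card I \<and> g ` Pow I = bottom r v ` Pow A"
proof (intro bexI exI conjI)
  let ?h = "\<lambda>j. g {j}"
  show gV: "g {} \<in> V" using assms(4) by auto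
  have "g {j} \<in> interval_nbrs (g {}) r" if "j \<in> I" for j
  proof -
    have "g {j} \<in> V" using that assms(4) by auto
    moreover have "d (g {}) (g {j}) = 1" using adj[of "{}" j] that by auto
    moreover have "d (g {j}) r + card {j} = d (g {}) r"
      by (rule cube_level) (use assms that in auto)
    ultimately show ?thesis unfolding interval_nbrs_def by auto
  qed
  then show "?h ` I \<subseteq> interval_nbrs (g {}) r" by blast
  have "inj_on ?h I" using assms(3) unfolding inj_on_def by blast
  then show "card (?h ` I) = card I" by (rule card_image)
  have bottom: "g X = bottom r (g {}) (?h ` X)" if "X \<in> Pow I" for X
    by (rule bottom_eq[symmetric, OF gV], rule cube_corner) (use assms that in auto)
  have "g ` Pow I = (\<lambda>X. bottom r (g {}) (?h ` X)) ` Pow I" by (rule image_cong[OF refl bottom])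
  also have "\<dots> = bottom r (g {}) ` ((`) ?h ` Pow I)" by (simp only: image_image)
  also have "(`) ?h ` Pow I = Pow (?h ` I)" by (rule image_Pow_surj[OF refl])
  finally show "g ` Pow I = bottom r (g {}) ` Pow (?h ` I)" .
qed

text \<open>The top is the only vertex of the cube at maximal distance from \<open>r\<close>, so
  \<open>v = w\<close>. Injectivity of \<open>bottom r v\<close> on singletons then compares
  \<open>A\<close> and \<open>B\<close>.\<close>

lemma bottom_image_inj:
  assumes "r \<in> V" "v \<in> V" "A \<subseteq> interval_nbrs v r" "w \<in> V" "B \<subseteq> interval_nbrs w r"
    and eq: "bottom r v ` Pow A = bottom r w ` Pow B"
  shows "v = w \<and> A = B"
proof -
  have le: "d x r \<le> d u r \<and> (d x r = d u r \<longrightarrow> x = u)"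
    if x: "x \<in> bottom r u ` Pow C" and C: "u \<in> V" "C \<subseteq> interval_nbrs u r" for x u C
  proof -
    obtain X where X: "X \<subseteq> C" "x = bottom r u X" using x by auto
    then have "d x r + card X = d u r" using bottom_level assms(1) C by auto
    moreover have "finite X" using X C by (meson finite_interval_nbrs finite_subset)
    ultimately show ?thesis using X bottom_empty C by auto
  qed
  have "v \<in> bottom r v ` Pow A" "w \<in> bottom r w ` Pow B"
    using bottom_empty[OF assms(2)] bottom_empty[OF assms(4)] by (force intro: image_eqI[of _ _ "{}"])+
  then have vw: "v = w" using le[of v w B] le[of w v A] assms by (metis le_antisym)
  have sub: "C \<subseteq> D" if CD: "C \<subseteq> interval_nbrs v r" "D \<subseteq> interval_nbrs v r"
    and eq: "bottom r v ` Pow C = bottom r v ` Pow D" for C D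
  proof
    fix a assume a: "a \<in> C"
    then have "bottom r v {a} \<in> bottom r v ` Pow D" using eq by blast
    then obtain X where "X \<subseteq> D" "bottom r v {a} = bottom r v X" by auto
    then show "a \<in> D" using bottom_inj[of r v "{a}" X] assms(1,2) CD a by auto
  qed
  show ?thesis using vw sub[of A B] sub[of B A] assms by auto
qed

section \<open>The values taken by the down-degree\<close>

lemma interval_nbrs_self: "r \<in> V \<Longrightarrow> interval_nbrs r r = {}"
  unfolding interval_nbrs_def by auto

lemma interval_nbrs_nonempty:
  assumes "v \<in> V" "r \<in> V" "v \<noteq> r"
  shows "interval_nbrs v r \<noteq> {}"
  using step[OF assms] unfolding interval_nbrs_def by auto

text \<open>Going down one edge loses at most one downward neighbour, by the square completed at
  each of the others.\<close>

lemma degree_down_step: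
  assumes "r \<in> V" "v \<in> V" "a \<in> interval_nbrs v r"
  shows "card (interval_nbrs v r) \<le> card (interval_nbrs a r) + 1"
proof -
  let ?N = "interval_nbrs v r"
  let ?c = "\<lambda>b. bottom r v {a, b}"
  have a: "a \<in> V" "d a r + 1 = d v r" using assms unfolding interval_nbrs_def by auto
  have "inj_on ?c (?N - {a})"
  proof (rule inj_onI)
    fix b b' assume b: "b \<in> ?N - {a}" "b' \<in> ?N - {a}" "?c b = ?c b'"
    then have "{a, b} = {a, b'}" by (intro bottom_inj[OF assms(1,2)]) (use assms in auto)
    then show "b = b'" using b by auto
  qed
  moreover have "?c ` (?N - {a}) \<subseteq> interval_nbrs a r"
  proof
    fix x assume "x \<in> ?c ` (?N - {a})"
    then obtain b where b: "b \<in> ?N" "b \<noteq> a" "x = ?c b" by auto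
    have "x \<in> V" "d x r + 2 = d v r" "d a x = 1"
      using b assms bottom_in_V[of r v "{a, b}"] bottom_level[of r v "{a, b}"]
        dist_bottom_mono[of r v "{a}" "{a, b}"] bottom_singleton[OF assms(2,3)] by auto
    then show "x \<in> interval_nbrs a r" using a unfolding interval_nbrs_def by auto
  qed
  ultimately have "card (?N - {a}) \<le> card (interval_nbrs a r)" by (intro card_inj_on_le) auto
  then show ?thesis using assms(3) by simp
qed

text \<open>A discrete intermediate value argument: descend from \<open>v\<close> until the degree,
  which never drops by more than one per step, equals \<open>k\<close>.\<close>

lemma degree_attained:
  assumes "r \<in> V" "v \<in> V" "k \<le> card (interval_nbrs v r)"
  shows "\<exists>w\<in>V. card (interval_nbrs w r) = k"
  using assms(2,3)
proof (induction "d v r" arbitrary: v rule: less_induct)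
  case less
  show ?case
  proof (cases "card (interval_nbrs v r) = k")
    case False
    then have "interval_nbrs v r \<noteq> {}" using less.prems by auto
    then obtain a where a: "a \<in> interval_nbrs v r" by blast
    then have "k \<le> card (interval_nbrs a r)"
      using degree_down_step[OF assms(1) less.prems(1) a] False less.prems by linarith
    then show ?thesis using less.hyps[of a] a unfolding interval_nbrs_def by auto
  qed (use less.prems in auto)
qed

end

section \<open>Counting cubes\<close>

lemma coeff_one_plus_x_power: "coeff ([:1, 1:] ^ k) n = int (k choose n)"
proof (cases "n \<le> k")
  case False
  then show ?thesis by (simp add: coeff_eq_0 degree_linear_power)
qed (simp add: coeff_linear_poly_power)

text \<open>Brings adjacency in the hypercube to the shape of
  \<open>bottom_adjacent_iff\<close>.\<close>

lemma hypercube_adj_iff: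
  "hypercube_adj X Y \<longleftrightarrow> (\<exists>a. a \<notin> X \<and> Y = insert a X) \<or> (\<exists>a. a \<notin> Y \<and> X = insert a Y)"
proof -
  have "(X - Y) \<union> (Y - X) = {a} \<longleftrightarrow> a \<notin> X \<and> Y = insert a X \<or> a \<notin> Y \<and> X = insert a Y" for a
  proof
    assume "(X - Y) \<union> (Y - X) = {a}"
    then have e: "x \<in> X \<and> x \<notin> Y \<or> x \<in> Y \<and> x \<notin> X \<longleftrightarrow> x = a" for x
      by (simp add: set_eq_iff)
    show "a \<notin> X \<and> Y = insert a X \<or> a \<notin> Y \<and> X = insert a Y"
      using e by (cases "a \<in> X") (metis (no_types) insert_iff set_eqI)+
  qed blast
  then show ?thesis
    unfolding hypercube_adj_def One_nat_def card_1_singleton_iff by blast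
qed

text \<open>Symmetric difference with \<open>T\<close> is an involution. It serves to relabel a cube
  so that its top gets the label \<open>{}\<close>.\<close>

lemma sym_diff_bij_Pow:
  assumes "T \<subseteq> I"
  shows "bij_betw (\<lambda>X. (X - T) \<union> (T - X)) (Pow I) (Pow I)"
  by (rule bij_betw_byWitness[where f' = "\<lambda>X. (X - T) \<union> (T - X)"]) (use assms in auto)

lemma hypercube_adj_sym_diff:
  "hypercube_adj ((X - T) \<union> (T - X)) ((Y - T) \<union> (T - Y)) \<longleftrightarrow> hypercube_adj X Y"
proof -
  have "((X - T) \<union> (T - X)) - ((Y - T) \<union> (T - Y)) \<union> (((Y - T) \<union> (T - Y)) - ((X - T) \<union> (T - X)))
    = (X - Y) \<union> (Y - X)" by blast
  then show ?thesis unfolding hypercube_adj_def by simp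
qed

lemma hypercube_adj_image:
  assumes "inj_on h I" "X \<subseteq> I" "Y \<subseteq> I"
  shows "(\<exists>a. a \<notin> h ` X \<and> h ` Y = insert a (h ` X)) \<longleftrightarrow> (\<exists>j. j \<notin> X \<and> Y = insert j X)"
proof
  assume "\<exists>a. a \<notin> h ` X \<and> h ` Y = insert a (h ` X)"
  then obtain a where a: "a \<notin> h ` X" "h ` Y = insert a (h ` X)" by blast
  then obtain j where j: "j \<in> Y" "a = h j" by blast
  have "h ` Y = h ` insert j X" using a j by simp
  moreover have "insert j X \<subseteq> I" using assms(2,3) j by blast
  ultimately have "Y = insert j X" using inj_on_image_eq_iff[OF assms(1,3)] by blast
  then show "\<exists>j. j \<notin> X \<and> Y = insert j X" using j a by blast
next
  assume "\<exists>j. j \<notin> X \<and> Y = insert j X"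
  then obtain j where "j \<notin> X" "Y = insert j X" by blast
  then show "\<exists>a. a \<notin> h ` X \<and> h ` Y = insert a (h ` X)"
    using assms by (intro exI[of _ "h j"]) (auto dest: inj_onD)
qed

section \<open>Counting cubes by their tops\<close>

locale finite_median_graph = finite_median_metric +
  fixes E :: "'a \<Rightarrow> 'a \<Rightarrow> bool"
  assumes adjacent_iff: "E u v \<longleftrightarrow> u \<in> V \<and> v \<in> V \<and> d u v = 1"
begin

text \<open>The isomorphism composes \<open>bottom r v\<close> with the image map of an enumeration
  of \<open>A\<close>.\<close>

lemma induces_cube_bottom:
  assumes "r \<in> V" "v \<in> V" "A \<subseteq> interval_nbrs v r" "card A = i"
  shows "induces_cube V E i (bottom r v ` Pow A)"
proof -
  have "finite A" using assms(3) finite_subset by fastforce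
  then obtain h where h: "bij_betw h {..<i} A"
    using ex_bij_betw_nat_finite[of A] assms(4) by (metis atLeast0LessThan)
  then have h_inj: "inj_on h {..<i}" and h_im: "h ` {..<i} = A" unfolding bij_betw_def by auto
  have sub: "h ` X \<subseteq> interval_nbrs v r" if "X \<in> Pow {..<i}" for X using that h_im assms(3) by blast
  have "bij_betw (bottom r v) (Pow A) (bottom r v ` Pow A)"
    by (rule inj_on_imp_bij_betw, rule inj_onI, rule bottom_inj[OF assms(1,2)]) (use assms in auto)
  then have "bij_betw (bottom r v \<circ> (`) h) (Pow {..<i}) (bottom r v ` Pow A)"
    by (rule bij_betw_trans[OF bij_betw_Pow[OF h]])
  moreover have "E ((bottom r v \<circ> (`) h) X) ((bottom r v \<circ> (`) h) Y) \<longleftrightarrow> hypercube_adj X Y"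
    if X: "X \<in> Pow {..<i}" and Y: "Y \<in> Pow {..<i}" for X Y
  proof -
    have "E ((bottom r v \<circ> (`) h) X) ((bottom r v \<circ> (`) h) Y) \<longleftrightarrow>
        d (bottom r v (h ` X)) (bottom r v (h ` Y)) = 1"
      using adjacent_iff bottom_in_V[OF assms(1,2) sub[OF X]] bottom_in_V[OF assms(1,2) sub[OF Y]]
      by simp
    also have "\<dots> \<longleftrightarrow> hypercube_adj X Y"
      unfolding bottom_adjacent_iff[OF assms(1,2) sub[OF X] sub[OF Y]] hypercube_adj_iff
      using hypercube_adj_image[OF h_inj] X Y by simp
    finally show ?thesis .
  qed
  moreover have "bottom r v ` Pow A \<subseteq> V" using bottom_in_V assms by auto
  ultimately show ?thesis unfolding induces_cube_def by blast
qed

lemma induces_cubeE: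
  assumes "r \<in> V" "induces_cube V E i S"
  shows "\<exists>v\<in>V. \<exists>A. A \<subseteq> interval_nbrs v r \<and> card A = i \<and> S = bottom r v ` Pow A"
proof -
  let ?I = "{..<i}"
  obtain f where f: "bij_betw f (Pow ?I) S" "S \<subseteq> V"
    and fadj: "\<forall>X\<in>Pow ?I. \<forall>Y\<in>Pow ?I. E (f X) (f Y) \<longleftrightarrow> hypercube_adj X Y"
    using assms(2) unfolding induces_cube_def by blast
  \<comment> \<open>\<open>T\<close> labels a vertex of the cube farthest from \<open>r\<close>; one
    exists since the cube is finite.\<close>
  let ?L = "(\<lambda>X. d (f X) r) ` Pow ?I"
  have "Max ?L \<in> ?L" by (rule Max_in) (simp_all add: Pow_not_empty)
  then obtain T where T_Max: "Max ?L = d (f T) r" and T: "T \<in> Pow ?I" by blast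
  then have T_max: "d (f X) r \<le> d (f T) r" if "X \<in> Pow ?I" for X
    using Max_ge[of ?L "d (f X) r"] that T_Max by simp
  let ?t = "\<lambda>X. (X - T) \<union> (T - X)"
  have t_bij: "bij_betw ?t (Pow ?I) (Pow ?I)" using sym_diff_bij_Pow T by blast
  have t_Pow: "?t X \<in> Pow ?I" if "X \<subseteq> ?I" for X using that T by auto
  \<comment> \<open>The automorphism \<open>?t\<close> exchanges \<open>T\<close> and
    \<open>{}\<close>, so the top of the cube becomes \<open>g {}\<close>.\<close>
  define g where "g = f \<circ> ?t"
  have g_bij: "bij_betw g (Pow ?I) S" unfolding g_def by (rule bij_betw_trans[OF t_bij f(1)])
  have gT: "g {} = f T" unfolding g_def by simp
  have "\<exists>v\<in>V. \<exists>A. A \<subseteq> interval_nbrs v r \<and> card A = card ?I \<and> g ` Pow ?I = bottom r v ` Pow A"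
  proof (rule cube_eq_bottom_image[OF assms(1)])
    show "inj_on g (Pow ?I)" "g ` Pow ?I \<subseteq> V" using g_bij f(2) unfolding bij_betw_def by auto
    show "d (g X) r \<le> d (g {}) r" if "X \<subseteq> ?I" for X
      using T_max[OF t_Pow[OF that]] unfolding gT unfolding g_def by simp
    show "d (g X) (g (insert j X)) = 1" if "X \<subseteq> ?I" "j \<in> ?I" "j \<notin> X" for X j
    proof -
      have "hypercube_adj X (insert j X)" unfolding hypercube_adj_iff using that(3) by blast
      then have "hypercube_adj (?t X) (?t (insert j X))" by (simp only: hypercube_adj_sym_diff)
      then have "E (g X) (g (insert j X))"
        unfolding g_def comp_def using fadj t_Pow[of X] t_Pow[of "insert j X"] that by blast
      then show ?thesis using adjacent_iff by simp
    qed
  qed simp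
  moreover have "g ` Pow ?I = S" using g_bij unfolding bij_betw_def by (rule conjunct2)
  ultimately show ?thesis by (simp only: card_lessThan)
qed

text \<open>The cubes of dimension \<open>i\<close> correspond bijectively to the pairs of a top
  \<open>v\<close> and an \<open>i\<close>-element set of its down-neighbours.\<close>

lemma cube_count_eq:
  assumes "r \<in> V"
  shows "cube_count V E i = (\<Sum>v\<in>V. card (interval_nbrs v r) choose i)"
proof -
  define P where "P v = {A. A \<subseteq> interval_nbrs v r \<and> card A = i}" for v
  have "S \<in> (\<lambda>(v, A). bottom r v ` Pow A) ` Sigma V P" if cube: "induces_cube V E i S" for S
  proof -
    obtain v A where "v \<in> V" "A \<in> P v" and S: "S = bottom r v ` Pow A"
      using induces_cubeE[OF assms cube] unfolding P_def by blast
    then have "(v, A) \<in> Sigma V P" by simp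
    then show ?thesis by (rule rev_image_eqI) (simp only: S prod.case)
  qed
  moreover have "induces_cube V E i (bottom r v ` Pow A)" if "v \<in> V" "A \<in> P v" for v A
    using induces_cube_bottom[OF assms] that unfolding P_def by blast
  ultimately have "{S. induces_cube V E i S} = (\<lambda>(v, A). bottom r v ` Pow A) ` Sigma V P"
    by (intro set_eqI iffI) (simp, elim imageE SigmaE, simp)
  moreover have "inj_on (\<lambda>(v, A). bottom r v ` Pow A) (Sigma V P)"
  proof (rule inj_onI)
    fix x y
    assume x: "x \<in> Sigma V P" and y: "y \<in> Sigma V P"
      and eq: "(case x of (v, A) \<Rightarrow> bottom r v ` Pow A) = (case y of (v, A) \<Rightarrow> bottom r v ` Pow A)"
    from x obtain v A where v: "v \<in> V" "A \<in> P v" "x = (v, A)" by (rule SigmaE)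
    from y obtain w B where w: "w \<in> V" "B \<in> P w" "y = (w, B)" by (rule SigmaE)
    have "bottom r v ` Pow A = bottom r w ` Pow B" using eq unfolding v(3) w(3) prod.case .
    moreover have "A \<subseteq> interval_nbrs v r" "B \<subseteq> interval_nbrs w r"
      using v(2) w(2) unfolding P_def by simp_all
    ultimately have "v = w \<and> A = B" using bottom_image_inj[OF assms] v(1) w(1) by metis
    then show "x = y" using v(3) w(3) by simp
  qed
  ultimately have "cube_count V E i = card (Sigma V P)"
    unfolding cube_count_def by (simp add: card_image)
  also have "\<dots> = (\<Sum>v\<in>V. card (P v))"
    by (rule card_SigmaI) (auto simp: P_def finite_V)
  also have "\<dots> = (\<Sum>v\<in>V. card (interval_nbrs v r) choose i)"
    unfolding P_def by (simp add: n_subsets)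
  finally show ?thesis .
qed

lemma degree_le_card: "card (interval_nbrs v r) \<le> card V"
  using finite_V by (intro card_mono) (auto simp: interval_nbrs_def)

text \<open>A binomial coefficient is positive up to its upper index, so the dimensions that occur
  form an initial segment ending at the largest down-degree.\<close>

lemma max_cube_dim_eq:
  assumes "r \<in> V"
  shows "max_cube_dim V E = Max ((\<lambda>v. card (interval_nbrs v r)) ` V)"
proof -
  let ?D = "(\<lambda>v. card (interval_nbrs v r)) ` V"
  have pos: "cube_count V E i > 0 \<longleftrightarrow> (\<exists>v\<in>V. i \<le> card (interval_nbrs v r))" for i
    unfolding cube_count_eq[OF assms] using finite_V
    by (auto simp: not_less zero_less_iff_neq_zero)
  have "cube_count V E i > 0 \<longleftrightarrow> i \<le> Max ?D" for i
    unfolding pos using finite_V assms by (subst Max_ge_iff) auto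
  then have cubes: "{i. cube_count V E i > 0} = {..Max ?D}" by auto
  have "Max {..n} = n" for n :: nat by (rule Max_eqI) auto
  then show ?thesis unfolding max_cube_dim_def cubes .
qed

lemma cube_poly_eq:
  assumes "r \<in> V"
  shows "cube_poly V E = (\<Sum>v\<in>V. [:1, 1:] ^ card (interval_nbrs v r))"
proof (rule poly_eqI)
  fix n
  have "coeff (cube_poly V E) n = (if n \<le> card V then int (cube_count V E n) else 0)"
    unfolding cube_poly_def by (simp add: coeff_sum)
  also have "\<dots> = (\<Sum>v\<in>V. int (card (interval_nbrs v r) choose n))"
  proof (cases "n \<le> card V")
    \<comment> \<open>Cutting the cube polynomial off at \<open>card V\<close> loses nothing,
      because down-degrees do not exceed \<open>card V\<close>.\<close>
    case False
    then have "int (card (interval_nbrs v r) choose n) = 0" for v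
      using degree_le_card[of v r] by simp
    then show ?thesis using False by (simp only: if_False sum.neutral_const)
  qed (simp add: cube_count_eq[OF assms])
  also have "\<dots> = coeff (\<Sum>v\<in>V. [:1, 1:] ^ card (interval_nbrs v r)) n"
    by (simp add: coeff_sum coeff_one_plus_x_power)
  finally show "coeff (cube_poly V E) n = coeff (\<Sum>v\<in>V. [:1, 1:] ^ card (interval_nbrs v r)) n" .
qed

lemma cube_poly_expansion:
  assumes "r \<in> V"
  shows "\<exists>b :: nat \<Rightarrow> int. b 0 = 1 \<and> (\<forall>i\<le>max_cube_dim V E. b i > 0) \<and>
    cube_poly V E = (\<Sum>i\<le>max_cube_dim V E. smult (b i) ([:1, 1:] ^ i))"
proof (intro exI conjI allI impI)
  let ?deg = "\<lambda>v. card (interval_nbrs v r)"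
  let ?F = "\<lambda>i. {v \<in> V. ?deg v = i}"
  let ?b = "\<lambda>i. int (card (?F i))"
  \<comment> \<open>Every vertex other than \<open>r\<close> has a neighbour closer to
    \<open>r\<close>.\<close>
  have "?F 0 = {r}"
    using interval_nbrs_self[OF assms] interval_nbrs_nonempty assms by auto
  then show "?b 0 = 1" by simp
  show "?b i > 0" if i: "i \<le> max_cube_dim V E" for i
  proof -
    have "V \<noteq> {}" using assms by blast
    then obtain v where "v \<in> V" "i \<le> ?deg v"
      using i Max_ge_iff[of "?deg ` V" i] finite_V unfolding max_cube_dim_eq[OF assms] by auto
    then have "?F i \<noteq> {}" using degree_attained[OF assms] by blast
    then show ?thesis using finite_V by (simp add: card_gt_0_iff)
  qed
  have "cube_poly V E = (\<Sum>v\<in>V. [:1, 1:] ^ ?deg v)" by (rule cube_poly_eq[OF assms])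
  \<comment> \<open>Vertices are grouped by down-degree, whose maximum is the largest cube
    dimension.\<close>
  also have "\<dots> = (\<Sum>i\<le>max_cube_dim V E. \<Sum>v\<in>?F i. [:1, 1:] ^ ?deg v)"
    using finite_V max_cube_dim_eq[OF assms] by (intro sum.group[symmetric]) auto
  also have "\<dots> = (\<Sum>i\<le>max_cube_dim V E. smult (?b i) ([:1, 1:] ^ i))"
    by (intro sum.cong refl) (simp add: of_nat_poly)
  finally show "cube_poly V E = (\<Sum>i\<le>max_cube_dim V E. smult (?b i) ([:1, 1:] ^ i))" .
qed

end

section \<open>Graph distance\<close>

text \<open>\<open>successively\<close> has ready rules for appending and reversing lists.\<close>

lemma walk_iff_successively: "walk V E p \<longleftrightarrow> p \<noteq> [] \<and> set p \<subseteq> V \<and> successively E p"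
  unfolding walk_def successively_conv_nth by blast

lemma walk_betw_singleton: "u \<in> V \<Longrightarrow> walk_betw V E u [u] u"
  unfolding walk_betw_def walk_iff_successively by simp

text \<open>\<open>tl q\<close> removes the second copy of \<open>v\<close>, so that the numbers of
  edges add up.\<close>

lemma walk_betw_append:
  assumes "walk_betw V E u p v" "walk_betw V E v q w"
  shows "walk_betw V E u (p @ tl q) w"
proof -
  obtain q' where q: "q = v # q'"
    using assms(2) unfolding walk_betw_def walk_def by (cases q) auto
  then show ?thesis
    using assms unfolding walk_betw_def walk_iff_successively
    by (cases q') (auto simp: successively_append_iff)
qed

lemma walk_betw_rev:
  assumes "simple_graph V E" "walk_betw V E u p v"
  shows "walk_betw V E v (rev p) u"
proof -
  have "(\<lambda>x y. E y x) = E" using assms(1) unfolding simple_graph_def by blast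
  then have "successively E (rev p) = successively E p" unfolding successively_rev by (rule arg_cong)
  then show ?thesis
    using assms(2) unfolding walk_betw_def walk_iff_successively
    by (simp add: hd_rev last_rev del: successively_rev)
qed

lemma walk_betw_split:
  assumes "walk_betw V E u (p @ x # q) v"
  shows "walk_betw V E u (p @ [x]) x" "walk_betw V E x (x # q) v"
  using assms unfolding walk_betw_def walk_iff_successively
  by (auto simp: successively_append_iff hd_append split: if_splits)

section \<open>The path metric and betweenness\<close>

lemma gdist_le:
  assumes "walk_betw V E u p v" "length p \<le> Suc n"
  shows "gdist V E u v \<le> n"
proof -
  have "length p = Suc (length p - 1)" using assms(1) unfolding walk_betw_def walk_def by (cases p) auto
  then have "gdist V E u v \<le> length p - 1" unfolding gdist_def using assms(1) by (intro Least_le) blast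
  then show ?thesis using assms(2) by linarith
qed

lemma obtain_geodesic:
  assumes "connected_graph V E" "u \<in> V" "v \<in> V"
  obtains p where "walk_betw V E u p v" "length p = Suc (gdist V E u v)"
proof -
  obtain q where q: "walk_betw V E u q v" using assms unfolding connected_graph_def by blast
  then have "length q = Suc (length q - 1)" unfolding walk_betw_def walk_def by (cases q) auto
  then have "\<exists>n p. walk_betw V E u p v \<and> length p = Suc n" using q by blast
  then have "\<exists>p. walk_betw V E u p v \<and> length p = Suc (gdist V E u v)"
    unfolding gdist_def by (rule LeastI_ex)
  then show ?thesis using that by blast
qed

lemma gdist_triangle:
  assumes "connected_graph V E" "u \<in> V" "v \<in> V" "w \<in> V"
  shows "gdist V E u w \<le> gdist V E u v + gdist V E v w"
proof -
  obtain p q where "walk_betw V E u p v" "length p = Suc (gdist V E u v)"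
      "walk_betw V E v q w" "length q = Suc (gdist V E v w)"
    using obtain_geodesic assms by metis
  then show ?thesis by (intro gdist_le[OF walk_betw_append]) auto
qed

lemma gdist_sym:
  assumes "simple_graph V E" "connected_graph V E" "u \<in> V" "v \<in> V"
  shows "gdist V E u v = gdist V E v u"
proof -
  have "gdist V E x y \<le> gdist V E y x" if "x \<in> V" "y \<in> V" for x y
  proof -
    obtain p where "walk_betw V E y p x" "length p = Suc (gdist V E y x)"
      using obtain_geodesic assms(2) \<open>y \<in> V\<close> \<open>x \<in> V\<close> by metis
    then show ?thesis by (intro gdist_le[OF walk_betw_rev[OF assms(1)]]) auto
  qed
  then show ?thesis using assms by (simp add: le_antisym)
qed

lemma gdist_eq_0_iff:
  assumes "connected_graph V E" "u \<in> V" "v \<in> V"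
  shows "gdist V E u v = 0 \<longleftrightarrow> u = v"
proof
  obtain p where p: "walk_betw V E u p v" "length p = Suc (gdist V E u v)"
    using obtain_geodesic assms by metis
  then show "u = v" if "gdist V E u v = 0"
    using that unfolding walk_betw_def by (auto simp: length_Suc_conv)
  show "gdist V E u v = 0" if "u = v"
    using gdist_le[OF walk_betw_singleton[OF assms(2)], where n = 0] that by simp
qed

lemma gdist_edge:
  assumes "simple_graph V E" "connected_graph V E" "E u v"
  shows "gdist V E u v = 1"
proof -
  have V: "u \<in> V" "v \<in> V" "u \<noteq> v" using assms unfolding simple_graph_def by auto
  then have "walk_betw V E u [u, v] v" using assms(3) unfolding walk_betw_def walk_iff_successively by simp
  then have "gdist V E u v \<le> 1" by (rule gdist_le) simp
  moreover have "gdist V E u v \<noteq> 0" using gdist_eq_0_iff[OF assms(2)] V by simp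
  ultimately show ?thesis by linarith
qed

text \<open>The witness is the second vertex of a geodesic.\<close>

lemma gdist_step:
  assumes "simple_graph V E" "connected_graph V E" "u \<in> V" "v \<in> V" "u \<noteq> v"
  shows "\<exists>x\<in>V. E u x \<and> gdist V E x v + 1 = gdist V E u v"
proof -
  obtain p where p: "walk_betw V E u p v" "length p = Suc (gdist V E u v)"
    using obtain_geodesic assms by metis
  moreover have "gdist V E u v \<noteq> 0" using gdist_eq_0_iff assms by metis
  ultimately obtain x q where q: "p = u # x # q"
    unfolding walk_betw_def by (cases p; cases "tl p") auto
  then have x: "E u x" "x \<in> V" using p unfolding walk_betw_def walk_iff_successively by auto
  have "walk_betw V E x (x # q) v" using walk_betw_split(2)[of V E u "[u]" x q v] p q by simp
  moreover have "length (x # q) \<le> Suc (gdist V E u v - 1)" using p q by simp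
  ultimately have "gdist V E x v \<le> gdist V E u v - 1" by (rule gdist_le)
  moreover have "gdist V E u v \<le> gdist V E u x + gdist V E x v" using gdist_triangle assms x by metis
  ultimately show ?thesis using x gdist_edge[OF assms(1,2) x(1)] \<open>gdist V E u v \<noteq> 0\<close> by auto
qed

lemma adjacent_iff_gdist:
  assumes "simple_graph V E" "connected_graph V E"
  shows "E u v \<longleftrightarrow> u \<in> V \<and> v \<in> V \<and> gdist V E u v = 1"
proof
  assume "E u v"
  then show "u \<in> V \<and> v \<in> V \<and> gdist V E u v = 1"
    using gdist_edge[OF assms] assms(1) unfolding simple_graph_def by blast
next
  assume uv: "u \<in> V \<and> v \<in> V \<and> gdist V E u v = 1"
  then have "u \<noteq> v" using gdist_eq_0_iff[OF assms(2), of u v] by auto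
  then obtain x where "x \<in> V" "E u x" "gdist V E x v = 0" using gdist_step[OF assms] uv by force
  then show "E u v" using gdist_eq_0_iff[OF assms(2)] uv by metis
qed

text \<open>A geodesic through \<open>x\<close> splits at \<open>x\<close> into two walks that bound
  the distances; conversely, geodesics to and from \<open>x\<close> concatenate. This turns medians
  into metric conditions.\<close>

lemma on_geodesic_iff:
  assumes "connected_graph V E" "u \<in> V" "v \<in> V" "x \<in> V"
  shows "on_geodesic V E u v x \<longleftrightarrow> gdist V E u x + gdist V E x v = gdist V E u v"
proof
  assume "on_geodesic V E u v x"
  then obtain p q where p: "walk_betw V E u (p @ x # q) v" "length (p @ x # q) = Suc (gdist V E u v)"
    unfolding on_geodesic_def by (metis split_list)
  have "gdist V E u x \<le> length p" "gdist V E x v \<le> length q"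
    using walk_betw_split[OF p(1)] by (auto intro: gdist_le)
  then show "gdist V E u x + gdist V E x v = gdist V E u v"
    using p(2) gdist_triangle[OF assms(1,2,4,3)] by simp
next
  assume eq: "gdist V E u x + gdist V E x v = gdist V E u v"
  obtain p q where p: "walk_betw V E u p x" "length p = Suc (gdist V E u x)"
      "walk_betw V E x q v" "length q = Suc (gdist V E x v)"
    using obtain_geodesic assms by metis
  have "x \<in> set p" using p(1) unfolding walk_betw_def walk_def by auto
  then show "on_geodesic V E u v x"
    unfolding on_geodesic_def using walk_betw_append[OF p(1,3)] p(2,4) eq
    by (intro exI[of _ "p @ tl q"]) auto
qed

lemma finite_median_graph_gdist:
  assumes "finite V" "median_graph V E"
  shows "finite_median_graph V (gdist V E) E"
proof -
  have G: "simple_graph V E" "connected_graph V E"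
    and med: "\<And>u v w. u \<in> V \<Longrightarrow> v \<in> V \<Longrightarrow> w \<in> V \<Longrightarrow> \<exists>!x. is_median V E u v w x"
    using assms(2) unfolding median_graph_def by auto
  show ?thesis
  proof
    show "finite V" by (rule assms(1))
    show "gdist V E u v = gdist V E v u" if "u \<in> V" "v \<in> V" for u v
      by (rule gdist_sym[OF G that])
    show "gdist V E u v = 0 \<longleftrightarrow> u = v" if "u \<in> V" "v \<in> V" for u v
      by (rule gdist_eq_0_iff[OF G(2) that])
    show "gdist V E u w \<le> gdist V E u v + gdist V E v w" if "u \<in> V" "v \<in> V" "w \<in> V" for u v w
      by (rule gdist_triangle[OF G(2) that])
    show "E u v \<longleftrightarrow> u \<in> V \<and> v \<in> V \<and> gdist V E u v = 1" for u v
      by (rule adjacent_iff_gdist[OF G])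
    show "\<exists>x\<in>V. gdist V E u x = 1 \<and> gdist V E x v + 1 = gdist V E u v"
      if "u \<in> V" "v \<in> V" "u \<noteq> v" for u v
      using gdist_step[OF G that] gdist_edge[OF G] by blast
    show "\<exists>!x. x \<in> V \<and> gdist V E u x + gdist V E x v = gdist V E u v \<and>
        gdist V E u x + gdist V E x w = gdist V E u w \<and> gdist V E v x + gdist V E x w = gdist V E v w"
      if "u \<in> V" "v \<in> V" "w \<in> V" for u v w
    proof -
      have "is_median V E u v w x \<longleftrightarrow> x \<in> V \<and> gdist V E u x + gdist V E x v = gdist V E u v \<and>
        gdist V E u x + gdist V E x w = gdist V E u w \<and> gdist V E v x + gdist V E x w = gdist V E v w" for x
        unfolding is_median_def using on_geodesic_iff[OF G(2)] that by blast
      then show ?thesis using med[OF that] by simp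
    qed
  qed
qed

theorem theorem10:
  fixes V :: "'a set" and E :: "'a \<Rightarrow> 'a \<Rightarrow> bool"
  assumes "finite V" and "median_graph V E"
  shows "\<exists>b :: nat \<Rightarrow> int. b 0 = 1 \<and> (\<forall>i\<le>max_cube_dim V E. b i > 0) \<and>
           cube_poly V E = (\<Sum>i\<le>max_cube_dim V E. smult (b i) ([:1, 1:] ^ i))"
proof -
  interpret finite_median_graph V "gdist V E" E using finite_median_graph_gdist[OF assms] .
  \<comment> \<open>Any vertex can be the root; connectedness includes that \<open>V\<close> is
    nonempty.\<close>
  obtain r where "r \<in> V" using assms(2) unfolding median_graph_def connected_graph_def by blast
  then show ?thesis by (rule cube_poly_expansion)
qed

end
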